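(* Let $d\ge 1$, and suppose that the free minimal Cantor systems $(X,\varphi,\mathbb{Z}^d)$ and $(Y,\psi,\mathbb{Z}^d)$ are bounded orbit injection equivalent. Then $(G(\varphi),G(\varphi)_+)\cong(G(\psi),G(\psi)_+)$ as ordered groups, i.e. there is a group isomorphism $G(\varphi)\to G(\psi)$ mapping $G(\varphi)_+$ onto $G(\psi)_+$.
   Context: A dynamical system $(X,\varphi,\mathbb{Z}^d)$ is a compact space $X$ with an action $\varphi$ of $\mathbb{Z}^d$ by homeomorphisms $\varphi^z$. It is a Cantor system if $X$ is a Cantor set, free if the action is free, and minimal if every orbit is dense. Orbit injection: for free dynamical systems $(X,\varphi,\mathbb{Z}^d)$ and $(Y,\psi,\mathbb{Z}^d)$, a map $\theta:X\to Y$ is an orbit injection if it is a continuous open injection such that for all $x,y\in X$: there is $w\in\mathbb{Z}^d$ with $\varphi^w(x)=y$ if and only if there is $v\in\mathbb{Z}^d$ with $\psi^v(\theta(x))=\theta(y)$. Its cocycle is the (unique) function $\eta:X\times\mathbb{Z}^d\to\mathbb{Z}^d$ with $\psi^{\eta(x,w)}(\theta(x))=\theta(\varphi^w(x))$. The orbit injection is bounded if $\eta$ is continuous. Two free minimal Cantor systems $(X,\varphi,\mathbb{Z}^d)$ and $(Y,\psi,\mathbb{Z}^d)$ are bounded orbit injection equivalent if there is a free minimal Cantor system $(Z,\alpha,\mathbb{Z}^d)$ with bounded orbit injections from $(X,\varphi,\mathbb{Z}^d)$ to $(Z,\alpha,\mathbb{Z}^d)$ and from $(Y,\psi,\mathbb{Z}^d)$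 to $(Z,\alpha,\mathbb{Z}^d)$. Ordered group: $G(\varphi)=C(X,\mathbb{Z})/B(\varphi)$, where $B(\varphi)$ is the subgroup of $C(X,\mathbb{Z})$ generated by the functions $1_A-1_{\varphi^vA}$ with $A\subseteq X$ clopen and $v\in\mathbb{Z}^d$ (equivalently, by all $f-f\circ\varphi^v$ with $f\in C(X,\mathbb{Z})$, $v\in\mathbb{Z}^d$); and $G(\varphi)_+=\{[f]: f\in C(X,\mathbb{Z}),\ f(x)\ge 0\text{ for all }x\in X\}$. *)

theory Defs
  imports "HOL-Analysis.Analysis" "HOL-Algebra.Generated_Groups"
begin

text \<open>
  The group of the integer vectors of length \<open>d\<close> is the type \<open>int ^ 'd\<close>, with \<open>d\<close> the
  (automatically positive) cardinality of the finite type \<open>'d\<close>.  Spaces are given by a topology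
  \<open>X\<close> with carrier \<open>topspace X\<close>; an action is only constrained on \<open>topspace X\<close>.
\<close>

definition cantor_space :: "'a topology \<Rightarrow> bool" where
  "cantor_space X \<longleftrightarrow>
     X homeomorphic_space product_topology (\<lambda>_::nat. discrete_topology (UNIV :: bool set)) UNIV"

definition dynamical_system :: "'a topology \<Rightarrow> (int ^ 'd \<Rightarrow> 'a \<Rightarrow> 'a) \<Rightarrow> bool" where
  "dynamical_system X \<phi> \<longleftrightarrow>
     compact_space X \<and>
     (\<forall>v. homeomorphic_map X X (\<phi> v)) \<and>
     (\<forall>x\<in>topspace X. \<phi> 0 x = x) \<and>
     (\<forall>v w. \<forall>x\<in>topspace X. \<phi> (v + w) x = \<phi> v (\<phi> w x))"

definition free_action :: "'a topology \<Rightarrow> (int ^ 'd \<Rightarrow> 'a \<Rightarrow> 'a) \<Rightarrow> bool" where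
  "free_action X \<phi> \<longleftrightarrow> (\<forall>x\<in>topspace X. \<forall>v. \<phi> v x = x \<longrightarrow> v = 0)"

definition minimal_action :: "'a topology \<Rightarrow> (int ^ 'd \<Rightarrow> 'a \<Rightarrow> 'a) \<Rightarrow> bool" where
  "minimal_action X \<phi> \<longleftrightarrow>
     (\<forall>x\<in>topspace X. X closure_of (range (\<lambda>v. \<phi> v x)) = topspace X)"

definition free_minimal_cantor_system :: "'a topology \<Rightarrow> (int ^ 'd \<Rightarrow> 'a \<Rightarrow> 'a) \<Rightarrow> bool" where
  "free_minimal_cantor_system X \<phi> \<longleftrightarrow>
     dynamical_system X \<phi> \<and> cantor_space X \<and> free_action X \<phi> \<and> minimal_action X \<phi>"

definition orbit_injection ::
    "'a topology \<Rightarrow> (int ^ 'd \<Rightarrow> 'a \<Rightarrow> 'a) \<Rightarrow> 'b topology \<Rightarrow> (int ^ 'd \<Rightarrow> 'b \<Rightarrow> 'b)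
      \<Rightarrow> ('a \<Rightarrow> 'b) \<Rightarrow> bool" where
  "orbit_injection X \<phi> Y \<psi> \<theta> \<longleftrightarrow>
     continuous_map X Y \<theta> \<and> open_map X Y \<theta> \<and> inj_on \<theta> (topspace X) \<and>
     (\<forall>x\<in>topspace X. \<forall>y\<in>topspace X.
        (\<exists>w. \<phi> w x = y) \<longleftrightarrow> (\<exists>v. \<psi> v (\<theta> x) = \<theta> y))"

text \<open>
  For an orbit injection into a free system the vector described here exists and is unique
  whenever \<open>x \<in> topspace X\<close>.
\<close>

definition orbit_cocycle ::
    "(int ^ 'd \<Rightarrow> 'a \<Rightarrow> 'a) \<Rightarrow> (int ^ 'd \<Rightarrow> 'b \<Rightarrow> 'b) \<Rightarrow> ('a \<Rightarrow> 'b)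
      \<Rightarrow> 'a \<times> (int ^ 'd) \<Rightarrow> int ^ 'd" where
  "orbit_cocycle \<phi> \<psi> \<theta> = (\<lambda>(x, w). THE v. \<psi> v (\<theta> x) = \<theta> (\<phi> w x))"

definition bounded_orbit_injection ::
    "'a topology \<Rightarrow> (int ^ 'd \<Rightarrow> 'a \<Rightarrow> 'a) \<Rightarrow> 'b topology \<Rightarrow> (int ^ 'd \<Rightarrow> 'b \<Rightarrow> 'b)
      \<Rightarrow> ('a \<Rightarrow> 'b) \<Rightarrow> bool" where
  "bounded_orbit_injection X \<phi> Y \<psi> \<theta> \<longleftrightarrow>
     orbit_injection X \<phi> Y \<psi> \<theta> \<and>
     continuous_map (prod_topology X (discrete_topology UNIV)) (discrete_topology UNIV)
       (orbit_cocycle \<phi> \<psi> \<theta>)"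

text \<open>
  HOL cannot quantify existentially over the type underlying the third system, so that type is a
  parameter.  In the hypothesis of a theorem, with \<open>'c\<close> a type variable not occurring in the
  conclusion, it is as good as existentially quantified.
\<close>

definition bounded_orbit_injection_equivalent ::
    "'c itself \<Rightarrow> 'a topology \<Rightarrow> (int ^ 'd \<Rightarrow> 'a \<Rightarrow> 'a) \<Rightarrow> 'b topology
      \<Rightarrow> (int ^ 'd \<Rightarrow> 'b \<Rightarrow> 'b) \<Rightarrow> bool" where
  "bounded_orbit_injection_equivalent (_ :: 'c itself) X \<phi> Y \<psi> \<longleftrightarrow>
     (\<exists>(Z :: 'c topology) (\<alpha> :: int ^ 'd \<Rightarrow> 'c \<Rightarrow> 'c) \<theta> \<theta>'.
        free_minimal_cantor_system Z \<alpha> \<and>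
        bounded_orbit_injection X \<phi> Z \<alpha> \<theta> \<and>
        bounded_orbit_injection Y \<psi> Z \<alpha> \<theta>')"

text \<open>
  The additive group of continuous integer-valued functions, in the multiplicative notation of
  \<^theory>\<open>HOL-Algebra.Group\<close>.  Its elements are extensional functions, so that they are determined
  by their values on \<open>topspace X\<close>.
\<close>

definition cont_int :: "'a topology \<Rightarrow> ('a \<Rightarrow> int) monoid" where
  "cont_int X =
     \<lparr> carrier = {f \<in> extensional (topspace X). continuous_map X (discrete_topology UNIV) f},
       mult = (\<lambda>f g. \<lambda>x\<in>topspace X. f x + g x),
       one = (\<lambda>x\<in>topspace X. 0) \<rparr>"

definition coboundary_subgroup :: "'a topology \<Rightarrow> (int ^ 'd \<Rightarrow> 'a \<Rightarrow> 'a) \<Rightarrow> ('a \<Rightarrow> int) set" where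
  "coboundary_subgroup X \<phi> =
     generate (cont_int X)
       {(\<lambda>x\<in>topspace X. indicator A x - indicator (\<phi> v ` A) x) | A v. openin X A \<and> closedin X A}"

definition dyn_group ::
    "'a topology \<Rightarrow> (int ^ 'd \<Rightarrow> 'a \<Rightarrow> 'a) \<Rightarrow> ('a \<Rightarrow> int) set monoid" where
  "dyn_group X \<phi> = cont_int X Mod coboundary_subgroup X \<phi>"

definition dyn_group_pos ::
    "'a topology \<Rightarrow> (int ^ 'd \<Rightarrow> 'a \<Rightarrow> 'a) \<Rightarrow> ('a \<Rightarrow> int) set set" where
  "dyn_group_pos X \<phi> =
     {coboundary_subgroup X \<phi> #>\<^bsub>cont_int X\<^esub> f | f.
        f \<in> carrier (cont_int X) \<and> (\<forall>x\<in>topspace X. f x \<ge> 0)}"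

end

(*
  A bounded orbit injection from X to Z with clopen image E induces an isomorphism G(X) -> G(Z):
  transport f from X to E and extend it by zero. Coboundaries go to coboundaries because the
  cocycle is locally constant, so that translates become translates piecewise. In the other
  direction, minimality and compactness give a locally constant kappa on Z, zero on E, such that
  z |-> alpha^(kappa z) z maps Z into E; summing a function over the fibres of this map gives a
  function on X. This inverts the extension exactly on one side and up to a coboundary on the other.
  That it respects coboundaries rests on the fact that two points of E in the same Z-orbit come
  from the same X-orbit. Both maps preserve nonnegativity.
*)
theory Submission
  imports Defs
begin

section \<open>Locally constant functions\<close>

text \<open>Continuity into a discrete space encodes local constancy uniformly for integers,
  vectors, truth values and options.\<close>

abbreviation loc_const :: "'a topology \<Rightarrow> ('a \<Rightarrow> 'b) \<Rightarrow> bool" where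
  "loc_const X f \<equiv> continuous_map X (discrete_topology UNIV) f"

lemma loc_const_iff: "loc_const X f \<longleftrightarrow> (\<forall>u. openin X {x \<in> topspace X. f x = u})"
proof
  assume "loc_const X f"
  then show "\<forall>u. openin X {x \<in> topspace X. f x = u}"
    using openin_continuous_map_preimage[of X "discrete_topology UNIV" f "{u}" for u] by auto
next
  assume op: "\<forall>u. openin X {x \<in> topspace X. f x = u}"
  have "openin X {x \<in> topspace X. f x \<in> U}" for U
  proof -
    have "{x \<in> topspace X. f x \<in> U} = (\<Union>u\<in>U. {x \<in> topspace X. f x = u})" by auto
    then show ?thesis using op by auto
  qed
  then show "loc_const X f" by (auto simp: continuous_map_def)
qed

text \<open>The level sets of the pair map are intersections of open sets, and every function on a
  discrete space is continuous. Hence arbitrary pointwise operations, including case distinctions,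
  preserve local constancy.\<close>

lemma loc_const_combine:
  assumes "loc_const X f" "loc_const X g"
  shows "loc_const X (\<lambda>x. h (f x) (g x))"
proof -
  have "loc_const X (\<lambda>x. (f x, g x))"
    unfolding loc_const_iff
  proof
    fix u :: "'b \<times> 'c"
    have "{x \<in> topspace X. (f x, g x) = u}
        = {x \<in> topspace X. f x = fst u} \<inter> {x \<in> topspace X. g x = snd u}" by auto
    then show "openin X {x \<in> topspace X. (f x, g x) = u}"
      using assms unfolding loc_const_iff by auto
  qed
  from continuous_map_compose[OF this, of "discrete_topology UNIV" "case_prod h"]
  show ?thesis by (simp add: o_def)
qed

lemma loc_const_map: "loc_const X f \<Longrightarrow> loc_const X (\<lambda>x. h (f x))"
  using loc_const_combine[of X f f "\<lambda>a b. h a"] by simp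

lemma loc_const_cong:
  assumes "loc_const X f" "\<And>x. x \<in> topspace X \<Longrightarrow> f x = g x"
  shows "loc_const X g"
  using assms continuous_map_eq by metis

lemma loc_const_clopen:
  assumes "loc_const X f"
  shows "openin X {x \<in> topspace X. P (f x)}" "closedin X {x \<in> topspace X. P (f x)}"
  using openin_continuous_map_preimage[OF assms, of "Collect P"]
    closedin_continuous_map_preimage[OF assms, of "Collect P"] by auto

text \<open>Turns a clopen set into a boolean function, so that definitions by cases on the set fall
  under \<open>loc_const_combine\<close>.\<close>

lemma loc_const_mem:
  assumes "openin X A" "closedin X A"
  shows "loc_const X (\<lambda>x. x \<in> A)"
  unfolding loc_const_iff
proof
  fix u :: bool
  have "A \<subseteq> topspace X" using assms openin_subset by auto
  then have "{x \<in> topspace X. (x \<in> A) = u} = (if u then A else topspace X - A)" by auto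
  then show "openin X {x \<in> topspace X. (x \<in> A) = u}"
    using assms by auto
qed

lemma loc_const_sum:
  fixes f :: "'i \<Rightarrow> 'a \<Rightarrow> 'b::comm_monoid_add"
  assumes "\<And>i. i \<in> I \<Longrightarrow> loc_const X (f i)"
  shows "loc_const X (\<lambda>x. \<Sum>i\<in>I. f i x)"
  using assms
proof (induction I rule: infinite_finite_induct)
  case (insert i I)
  then show ?case using loc_const_combine[of X "f i" "\<lambda>x. \<Sum>i\<in>I. f i x" "(+)"] by simp
qed auto

text \<open>The image is compact, and compact subsets of a discrete space are finite. This is the
  source of all the finite decompositions below.\<close>

lemma loc_const_finite_image:
  assumes "compact_space X" "loc_const X f"
  shows "finite (f ` topspace X)"
  using image_compactin[OF _ assms(2), of "topspace X"] assms(1)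
  by (simp add: compact_space_def compactin_discrete_topology)

section \<open>Coboundaries\<close>

lemma carrier_cont_int:
  "f \<in> carrier (cont_int X) \<longleftrightarrow> f \<in> extensional (topspace X) \<and> loc_const X f"
  by (simp add: cont_int_def)

lemma restrict_in_cont_int:
  assumes "loc_const X f"
  shows "restrict f (topspace X) \<in> carrier (cont_int X)"
proof -
  have "loc_const X (restrict f (topspace X))" by (rule loc_const_cong[OF assms]) simp
  then show ?thesis by (simp add: carrier_cont_int)
qed

lemma mult_cont_int: "f \<otimes>\<^bsub>cont_int X\<^esub> g = (\<lambda>x\<in>topspace X. f x + g x)"
  by (simp add: cont_int_def)

lemma one_cont_int: "\<one>\<^bsub>cont_int X\<^esub> = (\<lambda>x\<in>topspace X. 0)"
  by (simp add: cont_int_def)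

lemma comm_group_cont_int: "comm_group (cont_int X)"
proof (rule comm_groupI)
  fix f g assume "f \<in> carrier (cont_int X)" "g \<in> carrier (cont_int X)"
  then have "loc_const X f" "loc_const X g" by (simp_all add: carrier_cont_int)
  from restrict_in_cont_int[OF loc_const_combine[OF this, of "(+)"]]
  show "f \<otimes>\<^bsub>cont_int X\<^esub> g \<in> carrier (cont_int X)" by (simp add: mult_cont_int)
next
  show "\<one>\<^bsub>cont_int X\<^esub> \<in> carrier (cont_int X)"
    unfolding one_cont_int by (rule restrict_in_cont_int) simp
next
  fix f assume f: "f \<in> carrier (cont_int X)"
  then have "(\<lambda>x\<in>topspace X. - f x) \<in> carrier (cont_int X)"
    using restrict_in_cont_int[OF loc_const_map[of X f uminus]] by (simp add: carrier_cont_int)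
  then show "\<exists>g\<in>carrier (cont_int X). g \<otimes>\<^bsub>cont_int X\<^esub> f = \<one>\<^bsub>cont_int X\<^esub>"
    by (rule bexI[rotated]) (auto simp: mult_cont_int one_cont_int)
qed (auto simp: mult_cont_int one_cont_int carrier_cont_int extensional_def fun_eq_iff)

lemma inv_cont_int:
  assumes f: "f \<in> carrier (cont_int X)"
  shows "inv\<^bsub>cont_int X\<^esub> f = (\<lambda>x\<in>topspace X. - f x)"
proof -
  interpret G: comm_group "cont_int X" by (rule comm_group_cont_int)
  have "(\<lambda>x\<in>topspace X. - f x) \<in> carrier (cont_int X)"
    using f restrict_in_cont_int[OF loc_const_map[of X f uminus]] by (simp add: carrier_cont_int)
  then show ?thesis
    using f by (intro G.inv_equality) (auto simp: mult_cont_int one_cont_int)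
qed

section \<open>Dynamical systems and the calculus of coboundaries\<close>

text \<open>The restriction makes the predicate apply to functions that are not extensional, so only
  values on \<open>topspace X\<close> matter.\<close>

definition cohomologous_to_zero ::
    "'a topology \<Rightarrow> (int ^ 'd \<Rightarrow> 'a \<Rightarrow> 'a) \<Rightarrow> ('a \<Rightarrow> int) \<Rightarrow> bool" where
  "cohomologous_to_zero X \<phi> f \<longleftrightarrow> restrict f (topspace X) \<in> coboundary_subgroup X \<phi>"

locale dyn_sys =
  fixes X :: "'a topology" and \<phi> :: "int ^ 'd \<Rightarrow> 'a \<Rightarrow> 'a"
  assumes dyn: "dynamical_system X \<phi>"
begin

abbreviation "cob \<equiv> cohomologous_to_zero X \<phi>"

sublocale G: comm_group "cont_int X" by (rule comm_group_cont_int)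

lemma compact: "compact_space X"
  using dyn by (simp add: dynamical_system_def)

lemma homeo: "homeomorphic_map X X (\<phi> v)"
  using dyn by (simp add: dynamical_system_def)

lemma act_in: "x \<in> topspace X \<Longrightarrow> \<phi> v x \<in> topspace X"
  using homeo[of v] homeomorphic_imp_surjective_map by blast

lemma act_zero [simp]: "x \<in> topspace X \<Longrightarrow> \<phi> 0 x = x"
  using dyn by (simp add: dynamical_system_def)

lemma act_add: "x \<in> topspace X \<Longrightarrow> \<phi> v (\<phi> w x) = \<phi> (v + w) x"
  using dyn by (simp add: dynamical_system_def)

lemma act_eq_iff:
  assumes xy: "x \<in> topspace X" "y \<in> topspace X"
  shows "\<phi> v x = y \<longleftrightarrow> x = \<phi> (- v) y"
proof -
  have "\<phi> (- v) (\<phi> v x) = x" "\<phi> v (\<phi> (- v) y) = y"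
    using xy by (simp_all only: act_add left_minus right_minus act_zero)
  then show ?thesis by metis
qed

lemma mem_act_image:
  assumes "A \<subseteq> topspace X" "x \<in> topspace X"
  shows "x \<in> \<phi> v ` A \<longleftrightarrow> \<phi> (- v) x \<in> A"
proof
  assume "x \<in> \<phi> v ` A"
  then obtain a where "a \<in> A" "\<phi> v a = x" by blast
  then show "\<phi> (- v) x \<in> A" using assms act_eq_iff[of a x v] by auto
next
  assume *: "\<phi> (- v) x \<in> A"
  have "x = \<phi> v (\<phi> (- v) x)" using assms(2) by (simp add: act_add)
  then show "x \<in> \<phi> v ` A" using * by (rule image_eqI)
qed

lemma act_vec_eq_iff:
  assumes "free_action X \<phi>" "x \<in> topspace X"
  shows "\<phi> v x = \<phi> w x \<longleftrightarrow> v = w"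
proof
  assume "\<phi> v x = \<phi> w x"
  then have "\<phi> (- w) (\<phi> v x) = \<phi> (- w) (\<phi> w x)" by simp
  then have "\<phi> (- w + v) x = x" using assms(2) by (simp add: act_add)
  then have "- w + v = 0" using assms unfolding free_action_def by blast
  then show "v = w" by (simp add: algebra_simps)
qed simp

lemma loc_const_act: "loc_const X f \<Longrightarrow> loc_const X (\<lambda>x. f (\<phi> v x))"
  using continuous_map_compose[OF homeomorphic_imp_continuous_map[OF homeo[of v]]]
  by (simp add: o_def)

lemma openin_act: "A \<subseteq> topspace X \<Longrightarrow> openin X (\<phi> v ` A) \<longleftrightarrow> openin X A"
  using homeomorphic_map_openness[OF homeo] by blast

lemma closedin_act: "A \<subseteq> topspace X \<Longrightarrow> closedin X (\<phi> v ` A) \<longleftrightarrow> closedin X A"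
  using homeomorphic_map_closedness[OF homeo] by blast

lemma generators_subset:
  "{(\<lambda>x\<in>topspace X. indicator A x - indicator (\<phi> v ` A) x) | A v. openin X A \<and> closedin X A}
     \<subseteq> carrier (cont_int X)"
proof clarify
  fix A v assume A: "openin X A" "closedin X A"
  then have sub: "A \<subseteq> topspace X" by (simp add: openin_subset)
  have "loc_const X (\<lambda>x. x \<in> A)" "loc_const X (\<lambda>x. x \<in> \<phi> v ` A)"
    using A sub by (auto simp: openin_act closedin_act intro: loc_const_mem)
  from restrict_in_cont_int[OF loc_const_combine[OF this, of "\<lambda>p q. of_bool p - of_bool q"]]
  show "(\<lambda>x\<in>topspace X. indicator A x - indicator (\<phi> v ` A) x :: int) \<in> carrier (cont_int X)"
    by (simp add: indicator_def)
qed

lemma coboundary_subgroup: "subgroup (coboundary_subgroup X \<phi>) (cont_int X)"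
  unfolding coboundary_subgroup_def by (rule G.generate_is_subgroup[OF generators_subset])

lemma cob_cong: "cob f \<Longrightarrow> (\<And>x. x \<in> topspace X \<Longrightarrow> f x = g x) \<Longrightarrow> cob g"
  unfolding cohomologous_to_zero_def by (metis restrict_ext)

lemma cob_zero: "cob (\<lambda>x. 0)"
  using subgroup.one_closed[OF coboundary_subgroup]
  by (simp add: cohomologous_to_zero_def one_cont_int)

lemma cob_add:
  assumes "cob f" "cob g"
  shows "cob (\<lambda>x. f x + g x)"
proof -
  have "restrict f (topspace X) \<otimes>\<^bsub>cont_int X\<^esub> restrict g (topspace X) = (\<lambda>x\<in>topspace X. f x + g x)"
    by (auto simp: mult_cont_int)
  then show ?thesis
    using subgroup.m_closed[OF coboundary_subgroup] assms
    unfolding cohomologous_to_zero_def by metis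
qed

lemma cob_minus:
  assumes "cob f"
  shows "cob (\<lambda>x. - f x)"
proof -
  have "inv\<^bsub>cont_int X\<^esub> (restrict f (topspace X)) = (\<lambda>x\<in>topspace X. - f x)"
    using subgroup.mem_carrier[OF coboundary_subgroup] assms
    by (subst inv_cont_int) (auto simp: cohomologous_to_zero_def)
  then show ?thesis
    using subgroup.m_inv_closed[OF coboundary_subgroup] assms
    unfolding cohomologous_to_zero_def by metis
qed

lemma cob_sum:
  assumes "\<And>i. i \<in> I \<Longrightarrow> cob (f i)"
  shows "cob (\<lambda>x. \<Sum>i\<in>I. f i x)"
  using assms
proof (induction I rule: infinite_finite_induct)
  case (insert i I)
  then show ?case using cob_add[of "f i" "\<lambda>x. \<Sum>i\<in>I. f i x"] by simp
qed (auto simp: cob_zero)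

lemma cob_scale:
  assumes "cob f"
  shows "cob (\<lambda>x. c * f x)"
proof -
  have nat: "cob (\<lambda>x. int n * f x)" for n
    using cob_sum[of "{..<n}" "\<lambda>_. f"] assms by simp
  show ?thesis
  proof (cases c rule: int_cases2)
    case (nonneg n)
    then show ?thesis using nat by simp
  next
    case (nonpos n)
    then show ?thesis using cob_minus[OF nat[of n]] by simp
  qed
qed

lemma cob_indicator:
  assumes "openin X A" "closedin X A"
  shows "cob (\<lambda>x. indicator A x - indicator (\<phi> v ` A) x)"
  unfolding cohomologous_to_zero_def coboundary_subgroup_def
  by (rule generate.incl) (use assms in blast)

text \<open>By compactness, f is a finite integer combination of indicators of its clopen level
  sets, and the indicator of the translate of A by v is the indicator of A composed with the
  translation by -v.\<close>

lemma cob_translate: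
  fixes f :: "'a \<Rightarrow> int"
  assumes f: "loc_const X f"
  shows "cob (\<lambda>x. f x - f (\<phi> (- v) x))"
proof -
  define A where "A c = {x \<in> topspace X. f x = c}" for c
  have sub: "A c \<subseteq> topspace X" for c by (auto simp: A_def)
  have clopen: "openin X (A c)" "closedin X (A c)" for c
    using loc_const_clopen[OF f, of "\<lambda>y. y = c"] by (auto simp: A_def)
  have fin: "finite (f ` topspace X)" by (rule loc_const_finite_image[OF compact f])
  have expand: "f x = (\<Sum>c\<in>f ` topspace X. c * indicator (A c) x)" if "x \<in> topspace X" for x
  proof -
    have "(\<Sum>c\<in>f ` topspace X. c * indicator (A c) x) = (\<Sum>c\<in>f ` topspace X. if f x = c then c else 0)"
      using that by (intro sum.cong) (auto simp: A_def)
    also have "\<dots> = f x" using fin that by simp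
    finally show ?thesis by simp
  qed
  have "cob (\<lambda>x. \<Sum>c\<in>f ` topspace X. c * (indicator (A c) x - indicator (\<phi> v ` A c) x))"
    by (intro cob_sum cob_scale cob_indicator clopen)
  then show ?thesis
  proof (rule cob_cong)
    fix x assume x: "x \<in> topspace X"
    have "indicator (\<phi> v ` A c) x = (indicator (A c) (\<phi> (- v) x) :: int)" for c
      using mem_act_image[OF sub x] by (simp add: indicator_def)
    then show "(\<Sum>c\<in>f ` topspace X. c * (indicator (A c) x - indicator (\<phi> v ` A c) x))
        = f x - f (\<phi> (- v) x)"
      using expand[OF x] expand[OF act_in[OF x]]
      by (simp add: right_diff_distrib sum_subtractf)
  qed
qed

text \<open>D splits into finitely many clopen pieces on which w is constant, and on each piece the
  difference of indicators is a generator. Injectivity keeps the translated pieces disjoint, so that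
  their indicators add up to the indicator of the whole image.\<close>

lemma cob_piecewise_translate:
  fixes w :: "'a \<Rightarrow> int ^ 'd"
  assumes D: "openin X D" "closedin X D"
    and w: "\<And>u. openin X {x \<in> D. w x = u}"
    and inj: "inj_on (\<lambda>x. \<phi> (w x) x) D"
  shows "cob (\<lambda>x. indicator D x - indicator ((\<lambda>x. \<phi> (w x) x) ` D) x)"
proof -
  \<comment> \<open>The function w is controlled on D alone. The value \<open>None\<close> off D
    gives a locally constant function on all of X, to which compactness applies.\<close>
  define w' where "w' x = (if x \<in> D then Some (w x) else None)" for x
  define K where "K = w ` D"
  define D' where "D' u = {x \<in> D. w x = u}" for u
  have sub: "D \<subseteq> topspace X" using D openin_subset by auto
  have D'_alt: "D' u = {x \<in> topspace X. w' x = Some u}" for u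
    using sub by (auto simp: D'_def w'_def)
  have "loc_const X w'"
    unfolding loc_const_iff
  proof
    fix u :: "(int ^ 'd) option"
    show "openin X {x \<in> topspace X. w' x = u}"
    proof (cases u)
      case None
      then have "{x \<in> topspace X. w' x = u} = topspace X - D" by (auto simp: w'_def)
      then show ?thesis using D by auto
    next
      case (Some u')
      then show ?thesis using w[of u'] D'_alt[of u'] by (simp add: D'_def)
    qed
  qed
  then have fin': "finite (w' ` topspace X)" and clopen: "openin X (D' u)" "closedin X (D' u)" for u
    using loc_const_finite_image[OF compact] loc_const_clopen[of X w' "\<lambda>y. y = Some u"]
    by (auto simp: D'_alt)
  have "Some ` K \<subseteq> w' ` topspace X" using sub by (force simp: K_def w'_def)
  then have "finite (Some ` K)" using fin' by (rule finite_subset)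
  then have fin: "finite K" by (rule finite_imageD) simp
  have "cob (\<lambda>x. \<Sum>u\<in>K. indicator (D' u) x - indicator (\<phi> u ` D' u) x)"
    by (intro cob_sum cob_indicator clopen)
  then show ?thesis
  proof (rule cob_cong)
    fix x
    have im: "\<phi> u ` D' u = (\<lambda>x. \<phi> (w x) x) ` D' u" for u by (auto simp: D'_def)
    have disj: "disjoint_family_on D' K" by (auto simp: disjoint_family_on_def D'_def)
    have disj': "disjoint_family_on (\<lambda>u. \<phi> u ` D' u) K"
      unfolding disjoint_family_on_def im
    proof (intro ballI impI)
      fix a b :: "int ^ 'd" assume "a \<noteq> b"
      have "(\<lambda>x. \<phi> (w x) x) ` D' a \<inter> (\<lambda>x. \<phi> (w x) x) ` D' b = (\<lambda>x. \<phi> (w x) x) ` (D' a \<inter> D' b)"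
        by (rule inj_on_image_Int[OF inj, symmetric]) (auto simp: D'_def)
      then show "(\<lambda>x. \<phi> (w x) x) ` D' a \<inter> (\<lambda>x. \<phi> (w x) x) ` D' b = {}"
        using \<open>a \<noteq> b\<close> by (auto simp: D'_def)
    qed
    have UD: "(\<Union>u\<in>K. D' u) = D" by (auto simp: D'_def K_def)
    have UD': "(\<Union>u\<in>K. \<phi> u ` D' u) = (\<lambda>x. \<phi> (w x) x) ` D"
      by (simp only: im image_UN[symmetric] UD)
    show "(\<Sum>u\<in>K. indicator (D' u) x - indicator (\<phi> u ` D' u) x)
        = (indicator D x - indicator ((\<lambda>x. \<phi> (w x) x) ` D) x :: int)"
      by (simp only: sum_subtractf indicator_UN_disjoint[OF fin disj, symmetric]
          indicator_UN_disjoint[OF fin disj', symmetric] UD UD')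
  qed
qed

end

section \<open>Additive operators and coboundaries\<close>

text \<open>Reduces preservation of coboundaries to the generators, by induction over the generated
  subgroup. Additivity alone yields compatibility with zero and negation. The operator acts on all
  functions, so \<open>cong\<close> is what makes passing to extensional representatives
  harmless.\<close>

lemma cohomologous_to_zero_transfer:
  fixes X :: "'a topology" and \<phi> :: "int ^ 'd \<Rightarrow> 'a \<Rightarrow> 'a"
    and Y :: "'b topology" and \<psi> :: "int ^ 'd \<Rightarrow> 'b \<Rightarrow> 'b"
    and T :: "('a \<Rightarrow> int) \<Rightarrow> 'b \<Rightarrow> int"
  assumes "dynamical_system X \<phi>" "dynamical_system Y \<psi>"
    and cong: "\<And>f g y. (\<And>x. x \<in> topspace X \<Longrightarrow> f x = g x) \<Longrightarrow> y \<in> topspace Y \<Longrightarrow> T f y = T g y"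
    and add: "\<And>f g y. y \<in> topspace Y \<Longrightarrow> T (\<lambda>x. f x + g x) y = T f y + T g y"
    and gen: "\<And>A v. openin X A \<Longrightarrow> closedin X A \<Longrightarrow>
       cohomologous_to_zero Y \<psi> (T (\<lambda>x. indicator A x - indicator (\<phi> v ` A) x))"
    and f: "cohomologous_to_zero X \<phi> f"
  shows "cohomologous_to_zero Y \<psi> (T f)"
proof -
  interpret X: dyn_sys X \<phi> by unfold_locales fact
  interpret Y: dyn_sys Y \<psi> by unfold_locales fact
  have zero: "T (\<lambda>x. 0) y = 0" if "y \<in> topspace Y" for y
    using add[OF that, of "\<lambda>x. 0" "\<lambda>x. 0"] by simp
  have minus: "T (\<lambda>x. - f x) y = - T f y" if "y \<in> topspace Y" for f y
    using add[OF that, of "\<lambda>x. - f x" f] zero[OF that] by simp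
  let ?G = "{(\<lambda>x\<in>topspace X. indicator A x - indicator (\<phi> v ` A) x :: int) | A v.
    openin X A \<and> closedin X A}"
  have gen': "Y.cob (T g)" if "g \<in> ?G" for g
  proof -
    obtain A v where A: "openin X A" "closedin X A"
      and g: "g = (\<lambda>x\<in>topspace X. indicator A x - indicator (\<phi> v ` A) x)"
      using \<open>g \<in> ?G\<close> by blast
    show ?thesis by (rule Y.cob_cong[OF gen[OF A, of v]]) (auto simp: g intro: cong)
  qed
  have "Y.cob (T g)" if "g \<in> generate (cont_int X) ?G" for g
    using that
  proof (induction rule: generate.induct)
    case one
    show ?case
    proof (rule Y.cob_cong[OF Y.cob_zero])
      fix y assume y: "y \<in> topspace Y"
      have "T \<one>\<^bsub>cont_int X\<^esub> y = T (\<lambda>x. 0) y" by (rule cong[OF _ y]) (simp add: one_cont_int)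
      then show "0 = T \<one>\<^bsub>cont_int X\<^esub> y" using zero[OF y] by simp
    qed
  next
    case (incl g)
    then show ?case by (rule gen')
  next
    case (inv g)
    then have g: "g \<in> carrier (cont_int X)" using X.generators_subset by blast
    show ?case
    proof (rule Y.cob_cong[OF Y.cob_minus[OF gen'[OF inv]]])
      fix y assume y: "y \<in> topspace Y"
      have "T (inv\<^bsub>cont_int X\<^esub> g) y = T (\<lambda>x. - g x) y"
        by (rule cong[OF _ y]) (simp add: inv_cont_int[OF g])
      then show "- T g y = T (inv\<^bsub>cont_int X\<^esub> g) y" using minus[OF y] by simp
    qed
  next
    case (eng g h)
    show ?case
    proof (rule Y.cob_cong[OF Y.cob_add[OF eng.IH]])
      fix y assume y: "y \<in> topspace Y"
      have "T (g \<otimes>\<^bsub>cont_int X\<^esub> h) y = T (\<lambda>x. g x + h x) y"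
        by (rule cong[OF _ y]) (simp add: mult_cont_int)
      then show "T g y + T h y = T (g \<otimes>\<^bsub>cont_int X\<^esub> h) y" using add[OF y] by simp
    qed
  qed
  then have "Y.cob (T (restrict f (topspace X)))"
    using f by (simp add: cohomologous_to_zero_def coboundary_subgroup_def)
  then show ?thesis by (rule Y.cob_cong) (rule cong; simp)
qed

section \<open>Isomorphisms of quotient groups\<close>

text \<open>First isomorphism theorem for T followed by the projection modulo M: the kernel is N,
  and surjectivity is asked only up to M. The formula on cosets is kept in the conclusion because
  the positive cones have to be traced through the isomorphism.\<close>

lemma iso_Mod_lift:
  assumes G: "comm_group G" and H: "comm_group H" and N: "subgroup N G" and M: "subgroup M H"
    and T: "T \<in> hom G H"
    and ker: "\<And>f. f \<in> carrier G \<Longrightarrow> T f \<in> M \<longleftrightarrow> f \<in> N"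
    and surj: "\<And>g. g \<in> carrier H \<Longrightarrow> \<exists>f\<in>carrier G. g \<in> M #>\<^bsub>H\<^esub> T f"
  shows "\<exists>h \<in> iso (G Mod N) (H Mod M).
    \<forall>f\<in>carrier G. h (N #>\<^bsub>G\<^esub> f) = M #>\<^bsub>H\<^esub> T f"
proof -
  interpret G: comm_group G by fact
  interpret H: comm_group H by fact
  interpret M: normal M H using H.subgroup_imp_normal[OF M] .
  define k where "k f = M #>\<^bsub>H\<^esub> T f" for f
  have T_in: "T f \<in> carrier H" if "f \<in> carrier G" for f
    using T that by (rule hom_in_carrier)
  have hom: "k \<in> hom G (H Mod M)"
    using hom_compose[OF T M.r_coset_hom_Mod] by (simp add: k_def[abs_def] o_def)
  interpret HM: group "H Mod M" by (rule M.factorgroup_is_group)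
  interpret k: group_hom G "H Mod M" k by unfold_locales (rule hom)
  have one: "\<one>\<^bsub>H Mod M\<^esub> = M" by (simp add: FactGroup_def)
  have "k f = M \<longleftrightarrow> f \<in> N" if f: "f \<in> carrier G" for f
    using H.rcos_self[OF T_in[OF f] M] H.coset_join2[OF T_in[OF f] M] ker[OF f] by (auto simp: k_def)
  then have kernel: "kernel G (H Mod M) k = N"
    using subgroup.subset[OF N] by (auto simp: kernel_def one)
  have "k ` carrier G = carrier (H Mod M)"
  proof
    show "k ` carrier G \<subseteq> carrier (H Mod M)" by auto
    show "carrier (H Mod M) \<subseteq> k ` carrier G"
    proof
      fix c assume "c \<in> carrier (H Mod M)"
      then obtain g where g: "g \<in> carrier H" "c = M #>\<^bsub>H\<^esub> g"
        by (auto simp: FactGroup_def RCOSETS_def)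
      then obtain f where f: "f \<in> carrier G" "g \<in> M #>\<^bsub>H\<^esub> T f" using surj by blast
      then have "c = k f" using H.repr_independence[OF f(2) T_in[OF f(1)] M] g by (simp add: k_def)
      then show "c \<in> k ` carrier G" using f by blast
    qed
  qed
  from k.FactGroup_iso_set[OF this]
  have iso: "(\<lambda>C. the_elem (k ` C)) \<in> iso (G Mod N) (H Mod M)" by (simp add: kernel)
  \<comment> \<open>The map k is constant on each coset of its kernel N, so \<open>the_elem\<close>
    selects the common value.\<close>
  have "the_elem (k ` (N #>\<^bsub>G\<^esub> f)) = M #>\<^bsub>H\<^esub> T f" if f: "f \<in> carrier G" for f
  proof -
    have "k x = k f" if x: "x \<in> N #>\<^bsub>G\<^esub> f" for x
    proof -
      obtain n where n: "n \<in> N" "x = n \<otimes>\<^bsub>G\<^esub> f" using x by (auto simp: r_coset_def)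
      then have "n \<in> carrier G" "k n = \<one>\<^bsub>H Mod M\<^esub>" using kernel by (auto simp: kernel_def)
      then show ?thesis using f n k.hom_mult[of n f] HM.l_one[OF k.hom_closed[OF f]] by metis
    qed
    moreover have "f \<in> N #>\<^bsub>G\<^esub> f" by (rule G.rcos_self[OF f N])
    ultimately have "k ` (N #>\<^bsub>G\<^esub> f) = {k f}" by blast
    then show ?thesis by (simp add: k_def)
  qed
  then show ?thesis by (intro bexI[OF _ iso] ballI)
qed

section \<open>Bounded orbit injections\<close>

text \<open>Freeness of Z makes the cocycle unique, and freeness of X makes vectors between points
  of an X-orbit unique. Nonemptiness of X and minimality of Z let every Z-orbit meet the image of
  \<theta>; the Hausdorff property makes that image closed.\<close>

locale bounded_orbit_inj = X: dyn_sys X \<phi> + Z: dyn_sys Z \<alpha>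
  for X :: "'a topology" and \<phi> :: "int ^ 'd \<Rightarrow> 'a \<Rightarrow> 'a"
    and Z :: "'c topology" and \<alpha> :: "int ^ 'd \<Rightarrow> 'c \<Rightarrow> 'c" +
  fixes \<theta> :: "'a \<Rightarrow> 'c"
  assumes free_X: "free_action X \<phi>" and free_Z: "free_action Z \<alpha>"
    and minimal_Z: "minimal_action Z \<alpha>"
    and nonempty_X: "topspace X \<noteq> {}" and Hausdorff_Z: "Hausdorff_space Z"
    and boi: "bounded_orbit_injection X \<phi> Z \<alpha> \<theta>"
begin

abbreviation "cocycle x w \<equiv> orbit_cocycle \<phi> \<alpha> \<theta> (x, w)"

definition E where "E = \<theta> ` topspace X"

definition \<theta>inv where "\<theta>inv = inv_into (topspace X) \<theta>"

lemma theta_cont: "continuous_map X Z \<theta>" and theta_open: "open_map X Z \<theta>"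
  and theta_inj: "inj_on \<theta> (topspace X)"
  using boi by (simp_all add: bounded_orbit_injection_def orbit_injection_def)

lemma theta_orbit:
  "x \<in> topspace X \<Longrightarrow> y \<in> topspace X \<Longrightarrow> (\<exists>w. \<phi> w x = y) \<longleftrightarrow> (\<exists>v. \<alpha> v (\<theta> x) = \<theta> y)"
  using boi unfolding bounded_orbit_injection_def orbit_injection_def by blast

lemma theta_in: "x \<in> topspace X \<Longrightarrow> \<theta> x \<in> topspace Z"
  using theta_cont by (auto simp: continuous_map_def)

lemma theta_eq_iff: "x \<in> topspace X \<Longrightarrow> y \<in> topspace X \<Longrightarrow> \<theta> x = \<theta> y \<longleftrightarrow> x = y"
  using theta_inj by (simp add: inj_on_eq_iff)

lemma theta_in_E: "x \<in> topspace X \<Longrightarrow> \<theta> x \<in> E"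
  by (simp add: E_def)

lemma thetainv_theta [simp]: "x \<in> topspace X \<Longrightarrow> \<theta>inv (\<theta> x) = x"
  using theta_inj by (simp add: \<theta>inv_def)

text \<open>The definite description is meaningful: the orbit condition provides a vector, and
  freeness of \<alpha> makes it unique.\<close>

lemma cocycle_eq_iff:
  assumes "x \<in> topspace X"
  shows "cocycle x w = v \<longleftrightarrow> \<alpha> v (\<theta> x) = \<theta> (\<phi> w x)"
proof -
  obtain v' where v': "\<alpha> v' (\<theta> x) = \<theta> (\<phi> w x)"
    using theta_orbit[OF assms X.act_in[OF assms, of w]] by auto
  have uniq: "u = v'" if "\<alpha> u (\<theta> x) = \<theta> (\<phi> w x)" for u
    using that v' Z.act_vec_eq_iff[OF free_Z theta_in[OF assms], of u v'] by simp
  have "cocycle x w = v'"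
    unfolding orbit_cocycle_def prod.case using v' uniq by (rule the_equality)
  then show ?thesis using v' uniq by blast
qed

text \<open>Boundedness of the orbit injection enters here, by restricting the continuous cocycle to
  the slice with fixed w.\<close>

lemma loc_const_cocycle: "loc_const X (\<lambda>x. cocycle x w)"
proof -
  have "continuous_map X (prod_topology X (discrete_topology UNIV)) (\<lambda>x. (x, w))"
    by (simp add: continuous_map_pairwise o_def)
  moreover have "continuous_map (prod_topology X (discrete_topology UNIV)) (discrete_topology UNIV)
      (orbit_cocycle \<phi> \<alpha> \<theta>)"
    using boi by (simp add: bounded_orbit_injection_def)
  ultimately show ?thesis using continuous_map_compose by (fastforce simp: o_def)
qed

lemma openin_theta_image: "openin X A \<Longrightarrow> openin Z (\<theta> ` A)"
  using theta_open by (simp add: open_map_def)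

text \<open>Closed sets in the compact space X are compact, so their images are compact, hence
  closed in the Hausdorff space Z.\<close>

lemma closedin_theta_image: "closedin X A \<Longrightarrow> closedin Z (\<theta> ` A)"
  using compactin_imp_closedin[OF Hausdorff_Z] image_compactin[OF _ theta_cont]
    closedin_compact_space[OF X.compact] by blast

lemma E_clopen: "openin Z E" "closedin Z E"
  unfolding E_def by (auto intro: openin_theta_image closedin_theta_image)

subsection \<open>Extension by zero\<close>

definition extend :: "('a \<Rightarrow> int) \<Rightarrow> 'c \<Rightarrow> int" where
  "extend f z = (if z \<in> E then f (\<theta>inv z) else 0)"

lemma extend_theta: "x \<in> topspace X \<Longrightarrow> extend f (\<theta> x) = f x"
  by (simp add: extend_def theta_in_E)

lemma loc_const_extend:
  assumes "loc_const X f"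
  shows "loc_const Z (extend f)"
  unfolding loc_const_iff
proof
  fix u
  \<comment> \<open>The default value 0 adds the complement of E to the level set of 0; it is open
    because E is closed.\<close>
  have *: "{z \<in> topspace Z. extend f z = u}
      = \<theta> ` {x \<in> topspace X. f x = u} \<union> (if u = 0 then topspace Z - E else {})"
    by (auto simp: extend_def E_def theta_in dest: inj_onD[OF theta_inj])
  have "openin Z (\<theta> ` {x \<in> topspace X. f x = u})"
    using assms by (intro openin_theta_image) (simp add: loc_const_iff)
  then show "openin Z {z \<in> topspace Z. extend f z = u}"
    unfolding * using E_clopen by (auto intro!: openin_Un openin_diff)
qed

lemma extend_indicator:
  assumes "A \<subseteq> topspace X"
  shows "extend (indicator A) z = indicator (\<theta> ` A) z"
proof (cases "z \<in> E")
  case True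
  then obtain x where x: "x \<in> topspace X" "z = \<theta> x" by (auto simp: E_def)
  then have "z \<in> \<theta> ` A \<longleftrightarrow> x \<in> A" using assms theta_eq_iff by blast
  then show ?thesis using x by (simp add: extend_theta indicator_def)
next
  case False
  then have "z \<notin> \<theta> ` A" using assms by (auto simp: E_def)
  then show ?thesis using False by (simp add: extend_def)
qed

text \<open>The cocycle turns the single \<phi>-translate by v into \<alpha>-translates with a
  locally constant vector, so that \<open>cob_piecewise_translate\<close> applies to the image of
  A.\<close>

lemma cob_extend_generator:
  assumes A: "openin X A" "closedin X A"
  shows "Z.cob (extend (\<lambda>x. indicator A x - indicator (\<phi> v ` A) x))"
proof -
  have sub: "A \<subseteq> topspace X" using A openin_subset by auto
  then have sub': "\<phi> v ` A \<subseteq> topspace X" using X.act_in by auto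
  define w where "w z = cocycle (\<theta>inv z) v" for z
  have w: "\<alpha> (w (\<theta> x)) (\<theta> x) = \<theta> (\<phi> v x)" if "x \<in> A" for x
    using cocycle_eq_iff[of x v "w (\<theta> x)"] that sub by (auto simp: w_def)
  have im: "(\<lambda>z. \<alpha> (w z) z) ` \<theta> ` A = \<theta> ` \<phi> v ` A"
    unfolding image_image using w by (intro image_cong) auto
  have "Z.cob (\<lambda>z. indicator (\<theta> ` A) z - indicator ((\<lambda>z. \<alpha> (w z) z) ` \<theta> ` A) z)"
  proof (rule Z.cob_piecewise_translate)
    show "openin Z (\<theta> ` A)" "closedin Z (\<theta> ` A)"
      using A by (auto intro: openin_theta_image closedin_theta_image)
    fix u
    have "{z \<in> \<theta> ` A. w z = u} = \<theta> ` (A \<inter> {x \<in> topspace X. cocycle x v = u})"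
      using sub by (auto simp: w_def)
    moreover have "openin X (A \<inter> {x \<in> topspace X. cocycle x v = u})"
      using A loc_const_cocycle[of v] by (intro openin_Int) (auto simp: loc_const_iff)
    ultimately show "openin Z {z \<in> \<theta> ` A. w z = u}" by (simp add: openin_theta_image)
  next
    show "inj_on (\<lambda>z. \<alpha> (w z) z) (\<theta> ` A)"
    proof (rule inj_onI, clarify)
      fix x y assume xy: "x \<in> A" "y \<in> A"
        and "\<alpha> (w (\<theta> x)) (\<theta> x) = \<alpha> (w (\<theta> y)) (\<theta> y)"
      then have "\<theta> (\<phi> v x) = \<theta> (\<phi> v y)" by (simp add: w)
      then have "\<phi> v x = \<phi> v y" using xy sub sub' theta_eq_iff by (metis image_eqI subsetD)
      then have "x = y" using xy sub X.homeo[of v]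
        by (metis homeomorphic_imp_injective_map inj_on_eq_iff subsetD)
      then show "\<theta> x = \<theta> y" by simp
    qed
  qed
  then show ?thesis
  proof (rule Z.cob_cong)
    fix z
    have "extend (\<lambda>x. indicator A x - indicator (\<phi> v ` A) x) z
        = extend (indicator A) z - extend (indicator (\<phi> v ` A)) z"
      by (simp add: extend_def)
    then show "indicator (\<theta> ` A) z - indicator ((\<lambda>z. \<alpha> (w z) z) ` \<theta> ` A) z
        = extend (\<lambda>x. indicator A x - indicator (\<phi> v ` A) x) z"
      unfolding im using extend_indicator[OF sub] extend_indicator[OF sub'] by simp
  qed
qed

lemma cob_extend:
  assumes "X.cob f"
  shows "Z.cob (extend f)"
proof (rule cohomologous_to_zero_transfer[OF X.dyn Z.dyn _ _ _ assms])
  fix f g :: "'a \<Rightarrow> int" and z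
  assume "\<And>x. x \<in> topspace X \<Longrightarrow> f x = g x"
  then show "extend f z = extend g z" by (auto simp: extend_def E_def)
next
  fix f g :: "'a \<Rightarrow> int" and z
  show "extend (\<lambda>x. f x + g x) z = extend f z + extend g z" by (simp add: extend_def)
qed (rule cob_extend_generator)

subsection \<open>Collapsing onto the image\<close>

text \<open>E is open and nonempty, and the orbit of z is dense.\<close>

lemma returns_to_E:
  assumes "z \<in> topspace Z"
  shows "\<exists>v. \<alpha> v z \<in> E"
proof -
  obtain x where "x \<in> topspace X" using nonempty_X by blast
  then have e: "\<theta> x \<in> E" "\<theta> x \<in> Z closure_of (range (\<lambda>v. \<alpha> v z))"
    using assms minimal_Z theta_in by (auto simp: E_def minimal_action_def)
  then show ?thesis using E_clopen unfolding in_closure_of by blast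
qed

text \<open>By compactness, finitely many vectors suffice to bring every point into E, and a locally
  constant choice among them is made one vector at a time. The condition that the choice is zero on
  E makes collapsing an exact left inverse of extension.\<close>

lemma ex_return_vec:
  "\<exists>\<kappa>. loc_const Z \<kappa> \<and> (\<forall>z\<in>topspace Z. \<alpha> (\<kappa> z) z \<in> E) \<and> (\<forall>z\<in>E. \<kappa> z = 0)"
proof -
  define U where "U v = {z \<in> topspace Z. \<alpha> v z \<in> E}" for v
  have lc: "loc_const Z (\<lambda>z. \<alpha> v z \<in> E)" for v
    by (rule Z.loc_const_act[OF loc_const_mem[OF E_clopen]])
  have "openin Z (U v)" for v
    using loc_const_clopen[OF lc, of "\<lambda>b. b"] by (simp add: U_def)
  moreover have "\<Union> (range U) = topspace Z" using returns_to_E by (auto simp: U_def)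
  ultimately obtain \<F> where "finite \<F>" "\<F> \<subseteq> range U" "\<Union> \<F> = topspace Z"
    using Z.compact[unfolded compact_space, rule_format, of "range U"] by auto
  then obtain F where F: "finite F" "\<F> = U ` F"
    using finite_subset_image[of \<F> U UNIV] by auto
  then have cover: "\<exists>v\<in>F. \<alpha> v z \<in> E" if "z \<in> topspace Z" for z
    using that \<open>\<Union> \<F> = topspace Z\<close> by (auto simp: U_def)
  \<comment> \<open>For the induction over F, the return to E is demanded only where some vector of
    F achieves it; for empty F the zero function does.\<close>
  have "\<exists>\<kappa>. loc_const Z \<kappa> \<and> (\<forall>z\<in>topspace Z. (\<exists>v\<in>F. \<alpha> v z \<in> E) \<longrightarrow> \<alpha> (\<kappa> z) z \<in> E) \<and>
      (\<forall>z\<in>E. \<kappa> z = 0)"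
    using F(1)
  proof induction
    case empty
    show ?case by (rule exI[of _ "\<lambda>_. 0"]) simp
  next
    case (insert v F)
    then obtain \<kappa> where \<kappa>: "loc_const Z \<kappa>"
      "\<And>z. z \<in> topspace Z \<Longrightarrow> \<exists>v\<in>F. \<alpha> v z \<in> E \<Longrightarrow> \<alpha> (\<kappa> z) z \<in> E"
      "\<And>z. z \<in> E \<Longrightarrow> \<kappa> z = 0"
      by blast
    \<comment> \<open>Membership in E is tested first, which keeps the value 0 there; next the new
      vector v is tried, then the old choice.\<close>
    define \<kappa>' where "\<kappa>' z = (if z \<in> E then 0 else if \<alpha> v z \<in> E then v else \<kappa> z)" for z
    have "loc_const Z (\<lambda>z. if \<alpha> v z \<in> E then v else \<kappa> z)"
      by (rule loc_const_combine[OF lc[of v] \<kappa>(1), of "\<lambda>b k. if b then v else k"])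
    from loc_const_combine[OF loc_const_mem[OF E_clopen] this, of "\<lambda>b k. if b then 0 else k"]
    have "loc_const Z \<kappa>'" by (simp add: \<kappa>'_def[abs_def])
    moreover have "\<forall>z\<in>topspace Z. (\<exists>v\<in>insert v F. \<alpha> v z \<in> E) \<longrightarrow> \<alpha> (\<kappa>' z) z \<in> E"
      using \<kappa>(2) by (auto simp: \<kappa>'_def)
    moreover have "\<forall>z\<in>E. \<kappa>' z = 0" by (simp add: \<kappa>'_def)
    ultimately show ?case by blast
  qed
  then show ?thesis using cover by blast
qed

definition \<kappa> where
  "\<kappa> = (SOME \<kappa>. loc_const Z \<kappa> \<and> (\<forall>z\<in>topspace Z. \<alpha> (\<kappa> z) z \<in> E) \<and> (\<forall>z\<in>E. \<kappa> z = 0))"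

lemma loc_const_kappa: "loc_const Z \<kappa>"
  and kappa_in_E: "z \<in> topspace Z \<Longrightarrow> \<alpha> (\<kappa> z) z \<in> E"
  and kappa_E: "z \<in> E \<Longrightarrow> \<kappa> z = 0"
  using someI_ex[OF ex_return_vec] unfolding \<kappa>_def[symmetric] by blast+

definition K where "K = \<kappa> ` topspace Z"

lemma finite_K: "finite K"
  unfolding K_def by (rule loc_const_finite_image[OF Z.compact loc_const_kappa])

lemma kappa_K: "z \<in> topspace Z \<Longrightarrow> \<kappa> z \<in> K"
  by (simp add: K_def)

text \<open>Where \<kappa> equals u, the return map to E is the single translation by u. Cutting
  functions along these sets reduces fibre sums to translates.\<close>

definition piece :: "('c \<Rightarrow> int) \<Rightarrow> int ^ 'd \<Rightarrow> 'c \<Rightarrow> int" where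
  "piece f u z = (if \<kappa> z = u then f z else 0)"

text \<open>The value at \<open>x\<close> is the sum of \<open>f\<close> over the fibre of \<open>z \<mapsto> \<alpha> (\<kappa> z) z\<close> above \<open>\<theta> x\<close>.\<close>

definition collapse :: "('c \<Rightarrow> int) \<Rightarrow> 'a \<Rightarrow> int" where
  "collapse f x = (\<Sum>u\<in>K. piece f u (\<alpha> (- u) (\<theta> x)))"

lemma loc_const_piece: "loc_const Z f \<Longrightarrow> loc_const Z (piece f u)"
  unfolding piece_def
  by (rule loc_const_combine[OF loc_const_kappa, of _ "\<lambda>k y. if k = u then y else 0"])

lemma loc_const_collapse:
  assumes "loc_const Z f"
  shows "loc_const X (collapse f)"
proof -
  have "loc_const X (\<lambda>x. piece f u (\<alpha> (- u) (\<theta> x)))" for u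
    using continuous_map_compose[OF theta_cont Z.loc_const_act[OF loc_const_piece[OF assms]]]
    by (simp add: o_def)
  from loc_const_sum[OF this] show ?thesis by (simp add: collapse_def[abs_def])
qed

lemma collapse_nonneg:
  assumes "\<And>z. z \<in> topspace Z \<Longrightarrow> f z \<ge> 0" "x \<in> topspace X"
  shows "collapse f x \<ge> 0"
  unfolding collapse_def using assms Z.act_in[OF theta_in]
  by (intro sum_nonneg) (simp add: piece_def)

lemma collapse_cong:
  assumes "\<And>z. z \<in> topspace Z \<Longrightarrow> f z = g z" "x \<in> topspace X"
  shows "collapse f x = collapse g x"
  unfolding collapse_def using assms Z.act_in[OF theta_in]
  by (intro sum.cong) (simp_all add: piece_def)

lemma collapse_add: "collapse (\<lambda>z. f z + g z) x = collapse f x + collapse g x"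
  unfolding collapse_def sum.distrib[symmetric] by (intro sum.cong) (simp_all add: piece_def)

lemma collapse_diff: "collapse (\<lambda>z. f z - g z) x = collapse f x - collapse g x"
  unfolding collapse_def sum_subtractf[symmetric] by (intro sum.cong) (simp_all add: piece_def)

lemma collapse_sum: "collapse (\<lambda>z. \<Sum>i\<in>I. f i z) x = (\<Sum>i\<in>I. collapse (f i) x)"
proof (induction I rule: infinite_finite_induct)
  case (insert i I)
  then show ?case by (simp add: collapse_add)
qed (simp_all add: collapse_def piece_def)

text \<open>Only the term for u = 0 survives: a point with a nonzero return vector lies outside E,
  where the extension vanishes.\<close>

lemma collapse_extend:
  assumes x: "x \<in> topspace X"
  shows "collapse (extend f) x = f x"
proof -
  have "\<theta> x \<in> topspace Z" "\<theta> x \<in> E" using x by (auto simp: theta_in theta_in_E)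
  then have "0 \<in> K" using kappa_K[of "\<theta> x"] kappa_E by auto
  have "piece (extend f) u (\<alpha> (- u) (\<theta> x)) = (if u = 0 then f x else 0)" for u
    using x by (auto simp: piece_def extend_theta theta_in theta_in_E kappa_E) (auto simp: extend_def kappa_E)
  then show ?thesis using finite_K \<open>0 \<in> K\<close> by (simp add: collapse_def)
qed

text \<open>f is the sum of its pieces, and extending its collapse gives the sum of the same pieces,
  each translated by its own vector u. The difference is a finite sum of functions minus their
  translates.\<close>

lemma cob_extend_collapse:
  assumes f: "loc_const Z f"
  shows "Z.cob (\<lambda>z. f z - extend (collapse f) z)"
proof -
  have "Z.cob (\<lambda>z. \<Sum>u\<in>K. piece f u z - piece f u (\<alpha> (- u) z))"
    by (intro Z.cob_sum Z.cob_translate loc_const_piece f)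
  then show ?thesis
  proof (rule Z.cob_cong)
    fix z assume z: "z \<in> topspace Z"
    have "(\<Sum>u\<in>K. piece f u z) = f z"
      using finite_K kappa_K[OF z] by (simp add: piece_def)
    moreover have "(\<Sum>u\<in>K. piece f u (\<alpha> (- u) z)) = extend (collapse f) z"
    proof (cases "z \<in> E")
      case True
      then show ?thesis by (auto simp: E_def extend_theta collapse_def)
    next
      case False
      \<comment> \<open>Off E no translated piece contributes: a point with return vector u that is
        moved to z by u would put z into E.\<close>
      have "piece f u (\<alpha> (- u) z) = 0" for u
      proof -
        have "\<kappa> (\<alpha> (- u) z) \<noteq> u"
          using kappa_in_E[OF Z.act_in[OF z, of "- u"]] False z by (auto simp: Z.act_add)
        then show ?thesis by (simp add: piece_def)
      qed
      then show ?thesis using False by (simp add: extend_def)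
    qed
    ultimately show "(\<Sum>u\<in>K. piece f u z - piece f u (\<alpha> (- u) z)) = f z - extend (collapse f) z"
      by (simp add: sum_subtractf)
  qed
qed

text \<open>On C the return map is the injective translation by i, so a fibre contains at most one
  point of C, and just the summand for i can be nonzero.\<close>

lemma collapse_indicator:
  assumes C: "C \<subseteq> topspace Z" "\<And>z. z \<in> C \<Longrightarrow> \<kappa> z = i" and i: "i \<in> K" and x: "x \<in> topspace X"
  shows "collapse (indicator C) x = indicator {x \<in> topspace X. \<theta> x \<in> \<alpha> i ` C} x"
proof -
  have "piece (indicator C) u (\<alpha> (- u) (\<theta> x))
      = (if u = i then indicator {x \<in> topspace X. \<theta> x \<in> \<alpha> i ` C} x else 0)" for u
    using x C(2) Z.mem_act_image[OF C(1) theta_in[OF x], of i]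
    by (auto simp: piece_def indicator_def)
  then show ?thesis using finite_K i by (simp add: collapse_def)
qed

text \<open>
  Translates inside the image are translates piecewise along the orbits of \<open>X\<close>, since two points of
  \<open>E\<close> on the same \<open>\<alpha>\<close>-orbit come from the same \<open>\<phi>\<close>-orbit.
\<close>

lemma cob_preimage_translate:
  assumes D: "openin Z D" "closedin Z D" and DE0: "D \<subseteq> E" and DE: "\<alpha> u ` D \<subseteq> E"
  shows "X.cob (\<lambda>x. indicator {x \<in> topspace X. \<theta> x \<in> D} x
            - indicator {x \<in> topspace X. \<theta> x \<in> \<alpha> u ` D} x)"
proof -
  define D' where "D' = {x \<in> topspace X. \<theta> x \<in> D}"
  have subZ: "D \<subseteq> topspace Z" using D openin_subset by auto
  have sub: "D' \<subseteq> topspace X" by (auto simp: D'_def)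
  have ex: "\<exists>w. \<theta> (\<phi> w x) = \<alpha> u (\<theta> x)" if x: "x \<in> D'" for x
  proof -
    have "\<alpha> u (\<theta> x) \<in> E" using x DE by (auto simp: D'_def)
    then obtain y where y: "y \<in> topspace X" "\<theta> y = \<alpha> u (\<theta> x)" by (auto simp: E_def)
    then have "\<exists>v. \<alpha> v (\<theta> x) = \<theta> y" by metis
    then obtain w where "\<phi> w x = y" using theta_orbit x y(1) sub by blast
    then show ?thesis using y(2) by blast
  qed
  define w where "w x = (SOME w. \<theta> (\<phi> w x) = \<alpha> u (\<theta> x))" for x
  have w: "\<theta> (\<phi> (w x) x) = \<alpha> u (\<theta> x)" if "x \<in> D'" for x
    unfolding w_def by (rule someI_ex[OF ex[OF that]])
  \<comment> \<open>Freeness of X shows that the chosen vector is the only one. Its level sets are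
    thereby level sets of the cocycle, hence open.\<close>
  have w_eq: "w x = v \<longleftrightarrow> cocycle x v = u" if "x \<in> D'" for x v
  proof -
    have x: "x \<in> topspace X" using that sub by auto
    have "cocycle x v = u \<longleftrightarrow> \<theta> (\<phi> (w x) x) = \<theta> (\<phi> v x)"
      using cocycle_eq_iff[OF x] w[OF that] by metis
    also have "\<dots> \<longleftrightarrow> \<phi> (w x) x = \<phi> v x" using theta_eq_iff X.act_in x by blast
    also have "\<dots> \<longleftrightarrow> w x = v" by (rule X.act_vec_eq_iff[OF free_X x])
    finally show ?thesis by blast
  qed
  have im: "(\<lambda>x. \<phi> (w x) x) ` D' = {x \<in> topspace X. \<theta> x \<in> \<alpha> u ` D}"
  proof (intro equalityI subsetI)
    fix y assume "y \<in> (\<lambda>x. \<phi> (w x) x) ` D'"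
    then show "y \<in> {x \<in> topspace X. \<theta> x \<in> \<alpha> u ` D}"
      using w X.act_in by (auto simp: D'_def)
  next
    fix y assume "y \<in> {x \<in> topspace X. \<theta> x \<in> \<alpha> u ` D}"
    then obtain z where y: "y \<in> topspace X" and z: "z \<in> D" "\<theta> y = \<alpha> u z" by auto
    then have "\<alpha> (- u) (\<theta> y) = z" using subZ Z.act_eq_iff[of z "\<theta> y" u] theta_in[OF y] by auto
    moreover obtain x where "x \<in> topspace X" "z = \<theta> x"
      using z DE0 by (auto simp: E_def)
    ultimately show "y \<in> (\<lambda>x. \<phi> (w x) x) ` D'"
      using w[of x] z y theta_eq_iff[OF y X.act_in, of x "w x"] by (auto simp: D'_def)
  qed
  have "X.cob (\<lambda>x. indicator D' x - indicator ((\<lambda>x. \<phi> (w x) x) ` D') x)"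
  proof (rule X.cob_piecewise_translate)
    show "openin X D'" "closedin X D'"
      unfolding D'_def using D theta_cont
      by (auto intro: openin_continuous_map_preimage closedin_continuous_map_preimage)
    fix v
    have "{x \<in> D'. w x = v} = D' \<inter> {x \<in> topspace X. cocycle x v = u}"
      using w_eq sub by auto
    then show "openin X {x \<in> D'. w x = v}"
      using \<open>openin X D'\<close> loc_const_cocycle[of v] by (auto simp: loc_const_iff)
  next
    show "inj_on (\<lambda>x. \<phi> (w x) x) D'"
    proof (rule inj_onI)
      fix x y assume xy: "x \<in> D'" "y \<in> D'" and "\<phi> (w x) x = \<phi> (w y) y"
      then have "\<alpha> u (\<theta> x) = \<alpha> u (\<theta> y)" using w by metis
      then have "\<theta> x = \<theta> y"
        using xy sub theta_in Z.homeo[of u]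
        by (metis homeomorphic_imp_injective_map inj_on_eq_iff subsetD)
      then show "x = y" using xy sub theta_eq_iff by blast
    qed
  qed
  then show ?thesis unfolding im by (simp add: D'_def)
qed

text \<open>A is cut according to the return vectors i of z and j of its translate by v. On each
  piece both indicators collapse to indicators of preimages of subsets of E that are translates of
  one another, so \<open>cob_preimage_translate\<close> applies.\<close>

lemma cob_collapse_generator:
  assumes A: "openin Z A" "closedin Z A"
  shows "X.cob (collapse (\<lambda>z. indicator A z - indicator (\<alpha> v ` A) z))"
proof -
  have sub: "A \<subseteq> topspace Z" using A openin_subset by auto
  define B where "B p = {z \<in> A. \<kappa> z = fst p \<and> \<kappa> (\<alpha> v z) = snd p}" for p
  have B_alt: "B p = A \<inter> {z \<in> topspace Z. \<kappa> z = fst p} \<inter> {z \<in> topspace Z. \<kappa> (\<alpha> v z) = snd p}" for p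
    using sub by (auto simp: B_def)
  have B: "openin Z (B p)" "closedin Z (B p)" "B p \<subseteq> topspace Z" for p
    unfolding B_alt using A sub
      loc_const_clopen[OF loc_const_kappa, of "\<lambda>k. k = fst p"]
      loc_const_clopen[OF Z.loc_const_act[OF loc_const_kappa, of v], of "\<lambda>k. k = snd p"]
    by (auto intro!: openin_Int closedin_Int)
  have cob: "X.cob (\<lambda>x. collapse (indicator (B p)) x - collapse (indicator (\<alpha> v ` B p)) x)"
    if p: "p \<in> K \<times> K" for p
  proof -
    obtain i j where ij: "p = (i, j)" "i \<in> K" "j \<in> K" using p by auto
    let ?D = "\<alpha> i ` B p"
    \<comment> \<open>The vector undoes the return by i, translates by v, and then returns by
      j.\<close>
    have im: "\<alpha> (j + v - i) ` ?D = \<alpha> j ` \<alpha> v ` B p"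
      unfolding image_image using subsetD[OF B(3), of _ p] by (intro image_cong) (simp_all add: Z.act_add)
    have "?D \<subseteq> E" using kappa_in_E B(3) by (force simp: B_def ij(1))
    moreover have "\<alpha> j ` \<alpha> v ` B p \<subseteq> E"
      using kappa_in_E[OF Z.act_in] B(3) by (force simp: B_def ij(1))
    moreover have "openin Z ?D" "closedin Z ?D"
      using B by (simp_all add: Z.openin_act Z.closedin_act)
    ultimately have "X.cob (\<lambda>x. indicator {x \<in> topspace X. \<theta> x \<in> ?D} x
        - indicator {x \<in> topspace X. \<theta> x \<in> \<alpha> j ` \<alpha> v ` B p} x)"
      using cob_preimage_translate[of ?D "j + v - i"] unfolding im by blast
    then show ?thesis
    proof (rule X.cob_cong)
      fix x assume x: "x \<in> topspace X"
      have "collapse (indicator (B p)) x = indicator {x \<in> topspace X. \<theta> x \<in> ?D} x"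
        by (rule collapse_indicator[OF B(3) _ ij(2) x]) (simp add: B_def ij(1))
      moreover have "collapse (indicator (\<alpha> v ` B p)) x
          = indicator {x \<in> topspace X. \<theta> x \<in> \<alpha> j ` \<alpha> v ` B p} x"
        using B(3)[of p] Z.act_in
        by (intro collapse_indicator[OF _ _ ij(3) x]) (auto simp: B_def ij(1))
      ultimately show "indicator {x \<in> topspace X. \<theta> x \<in> ?D} x
          - indicator {x \<in> topspace X. \<theta> x \<in> \<alpha> j ` \<alpha> v ` B p} x
          = collapse (indicator (B p)) x - collapse (indicator (\<alpha> v ` B p)) x" by simp
    qed
  qed
  have "X.cob (\<lambda>x. \<Sum>p\<in>K \<times> K. collapse (indicator (B p)) x - collapse (indicator (\<alpha> v ` B p)) x)"
    by (intro X.cob_sum cob)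
  then show ?thesis
  proof (rule X.cob_cong)
    fix x assume x: "x \<in> topspace X"
    have fin: "finite (K \<times> K)" using finite_K by simp
    have disj: "disjoint_family_on B (K \<times> K)"
      by (auto simp: disjoint_family_on_def B_def)
    have disj': "disjoint_family_on (\<lambda>p. \<alpha> v ` B p) (K \<times> K)"
      unfolding disjoint_family_on_def
    proof (intro ballI impI)
      fix p q assume "p \<in> K \<times> K" "q \<in> K \<times> K" "p \<noteq> q"
      then have "B p \<inter> B q = {}" by (auto simp: B_def prod_eq_iff)
      then show "\<alpha> v ` B p \<inter> \<alpha> v ` B q = {}"
        using inj_on_image_Int[OF homeomorphic_imp_injective_map[OF Z.homeo[of v]] B(3)[of p] B(3)[of q]]
        by simp
    qed
    have UB: "(\<Union>p\<in>K \<times> K. B p) = A"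
    proof (intro equalityI subsetI)
      fix z assume "z \<in> A"
      then have "z \<in> B (\<kappa> z, \<kappa> (\<alpha> v z))" "(\<kappa> z, \<kappa> (\<alpha> v z)) \<in> K \<times> K"
        using sub kappa_K Z.act_in by (auto simp: B_def)
      then show "z \<in> (\<Union>p\<in>K \<times> K. B p)" by blast
    qed (auto simp: B_def)
    have UB': "(\<Union>p\<in>K \<times> K. \<alpha> v ` B p) = \<alpha> v ` A"
      by (simp only: image_UN[symmetric] UB)
    have "(\<lambda>z. indicator A z - indicator (\<alpha> v ` A) z :: int)
        = (\<lambda>z. \<Sum>p\<in>K \<times> K. indicator (B p) z - indicator (\<alpha> v ` B p) z)"
      by (simp only: sum_subtractf indicator_UN_disjoint[OF fin disj, symmetric]
          indicator_UN_disjoint[OF fin disj', symmetric] UB UB')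
    then show "(\<Sum>p\<in>K \<times> K. collapse (indicator (B p)) x - collapse (indicator (\<alpha> v ` B p)) x)
        = collapse (\<lambda>z. indicator A z - indicator (\<alpha> v ` A) z) x"
      by (simp add: collapse_sum collapse_diff)
  qed
qed

lemma cob_collapse:
  assumes "Z.cob f"
  shows "X.cob (collapse f)"
  by (rule cohomologous_to_zero_transfer[OF Z.dyn X.dyn collapse_cong collapse_add
        cob_collapse_generator assms])

section \<open>The ordered isomorphism induced by one bounded orbit injection\<close>

lemma ordered_iso:
  "\<exists>h \<in> iso (dyn_group X \<phi>) (dyn_group Z \<alpha>). h ` dyn_group_pos X \<phi> = dyn_group_pos Z \<alpha>"
proof -
  let ?T = "\<lambda>f. restrict (extend f) (topspace Z)"
  let ?R = "\<lambda>f. restrict (collapse f) (topspace X)"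
  let ?N = "coboundary_subgroup X \<phi>" and ?M = "coboundary_subgroup Z \<alpha>"
  have T_in: "?T f \<in> carrier (cont_int Z)" if "f \<in> carrier (cont_int X)" for f
    using that by (intro restrict_in_cont_int loc_const_extend) (simp add: carrier_cont_int)
  have R_in: "?R f \<in> carrier (cont_int X)" if "f \<in> carrier (cont_int Z)" for f
    using that by (intro restrict_in_cont_int loc_const_collapse) (simp add: carrier_cont_int)
  have hom: "?T \<in> hom (cont_int X) (cont_int Z)"
  proof (rule homI)
    fix f g
    show "?T (f \<otimes>\<^bsub>cont_int X\<^esub> g) = ?T f \<otimes>\<^bsub>cont_int Z\<^esub> ?T g"
      by (rule ext) (auto simp: mult_cont_int extend_def E_def)
  qed (rule T_in)
  \<comment> \<open>If the extension of f is a coboundary, then so is its collapse, which is f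
    itself; this gives injectivity on the quotients.\<close>
  have ker: "?T f \<in> ?M \<longleftrightarrow> f \<in> ?N" if "f \<in> carrier (cont_int X)" for f
  proof -
    have f: "restrict f (topspace X) = f"
      using that by (simp add: carrier_cont_int extensional_restrict)
    have "Z.cob (extend f) \<longleftrightarrow> X.cob f"
    proof
      assume "Z.cob (extend f)"
      then have "X.cob (collapse (extend f))" by (rule cob_collapse)
      then show "X.cob f" by (rule X.cob_cong) (rule collapse_extend)
    qed (rule cob_extend)
    then show ?thesis by (simp add: cohomologous_to_zero_def f)
  qed
  \<comment> \<open>Every class of Z is represented by an extension, namely that of the collapse of
    any representative. This serves both surjectivity and the positive cone.\<close>
  have coset: "g \<in> ?M #>\<^bsub>cont_int Z\<^esub> ?T (?R g)" if g: "g \<in> carrier (cont_int Z)" for g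
  proof -
    let ?m = "\<lambda>z\<in>topspace Z. g z - extend (collapse g) z"
    have "?m \<in> ?M"
      using cob_extend_collapse[of g] g by (simp add: carrier_cont_int cohomologous_to_zero_def)
    moreover have "g = ?m \<otimes>\<^bsub>cont_int Z\<^esub> ?T (?R g)"
    proof
      fix z
      have "extend (?R g) z = extend (collapse g) z" if "z \<in> topspace Z"
        by (auto simp: extend_def E_def)
      then show "g z = (?m \<otimes>\<^bsub>cont_int Z\<^esub> ?T (?R g)) z"
        using g by (auto simp: mult_cont_int carrier_cont_int extensional_def)
    qed
    ultimately show ?thesis unfolding r_coset_def by blast
  qed
  have "\<exists>f\<in>carrier (cont_int X). g \<in> ?M #>\<^bsub>cont_int Z\<^esub> ?T f"
    if "g \<in> carrier (cont_int Z)" for g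
    using coset[OF that] R_in[OF that] by (rule bexI)
  from iso_Mod_lift[OF comm_group_cont_int comm_group_cont_int X.coboundary_subgroup
      Z.coboundary_subgroup hom ker this]
  obtain h where iso: "h \<in> iso (dyn_group X \<phi>) (dyn_group Z \<alpha>)"
    and h: "\<And>f. f \<in> carrier (cont_int X) \<Longrightarrow>
      h (?N #>\<^bsub>cont_int X\<^esub> f) = ?M #>\<^bsub>cont_int Z\<^esub> ?T f"
    unfolding dyn_group_def by meson
  have "h ` dyn_group_pos X \<phi> = dyn_group_pos Z \<alpha>"
  proof (intro equalityI subsetI)
    fix c assume "c \<in> h ` dyn_group_pos X \<phi>"
    then obtain f where f: "f \<in> carrier (cont_int X)" "\<forall>x\<in>topspace X. f x \<ge> 0"
      and "c = h (?N #>\<^bsub>cont_int X\<^esub> f)"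
      by (auto simp: dyn_group_pos_def)
    then have "c = ?M #>\<^bsub>cont_int Z\<^esub> ?T f" by (simp add: h)
    moreover have "\<forall>z\<in>topspace Z. ?T f z \<ge> 0" using f by (auto simp: extend_def E_def)
    ultimately show "c \<in> dyn_group_pos Z \<alpha>" using T_in[OF f(1)] unfolding dyn_group_pos_def by blast
  next
    \<comment> \<open>A nonnegative representative g has a nonnegative collapse, whose class is the
      required positive preimage.\<close>
    fix c assume "c \<in> dyn_group_pos Z \<alpha>"
    then obtain g where g: "g \<in> carrier (cont_int Z)" "\<forall>z\<in>topspace Z. g z \<ge> 0"
      and c: "c = ?M #>\<^bsub>cont_int Z\<^esub> g"
      by (auto simp: dyn_group_pos_def)
    have "c = ?M #>\<^bsub>cont_int Z\<^esub> ?T (?R g)"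
      unfolding c by (rule Z.G.repr_independence[OF coset[OF g(1)] T_in[OF R_in[OF g(1)]]
            Z.coboundary_subgroup, symmetric])
    then have "c = h (?N #>\<^bsub>cont_int X\<^esub> ?R g)" by (simp only: h[OF R_in[OF g(1)]])
    moreover have "\<forall>x\<in>topspace X. ?R g x \<ge> 0" using g(2) collapse_nonneg[of g] by simp
    ultimately show "c \<in> h ` dyn_group_pos X \<phi>"
      using R_in[OF g(1)] unfolding dyn_group_pos_def by blast
  qed
  with iso show ?thesis by blast
qed

end

section \<open>From one orbit injection to bounded orbit injection equivalence\<close>

lemma cantor_space_nonempty_Hausdorff:
  assumes "cantor_space X"
  shows "topspace X \<noteq> {}" "Hausdorff_space X"
proof -
  let ?C = "product_topology (\<lambda>_::nat. discrete_topology (UNIV :: bool set)) UNIV"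
  have hom: "X homeomorphic_space ?C" using assms by (simp add: cantor_space_def)
  have "topspace ?C \<noteq> {}" by (simp del: null_topspace_iff_trivial)
  then show "topspace X \<noteq> {}"
    unfolding null_topspace_iff_trivial homeomorphic_empty_space[OF hom] .
  have "Hausdorff_space ?C"
    unfolding Hausdorff_space_product_topology by (simp add: Hausdorff_space_discrete_topology)
  then show "Hausdorff_space X" using homeomorphic_Hausdorff_space[OF hom] by blast
qed

lemma bounded_orbit_injI:
  assumes X: "free_minimal_cantor_system X \<phi>" and Z: "free_minimal_cantor_system Z \<alpha>"
    and "bounded_orbit_injection X \<phi> Z \<alpha> \<theta>"
  shows "bounded_orbit_inj X \<phi> Z \<alpha> \<theta>"
  using assms cantor_space_nonempty_Hausdorff[of X] cantor_space_nonempty_Hausdorff[of Z]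
  by unfold_locales (simp_all add: free_minimal_cantor_system_def)

theorem theorem3p12:
  fixes X :: "'a topology" and \<phi> :: "int ^ 'd \<Rightarrow> 'a \<Rightarrow> 'a"
    and Y :: "'b topology" and \<psi> :: "int ^ 'd \<Rightarrow> 'b \<Rightarrow> 'b"
  assumes "free_minimal_cantor_system X \<phi>"
    and "free_minimal_cantor_system Y \<psi>"
    and "bounded_orbit_injection_equivalent TYPE('c) X \<phi> Y \<psi>"
  shows "\<exists>h \<in> iso (dyn_group X \<phi>) (dyn_group Y \<psi>).
           h ` dyn_group_pos X \<phi> = dyn_group_pos Y \<psi>"
proof -
  obtain Z :: "'c topology" and \<alpha> :: "int ^ 'd \<Rightarrow> 'c \<Rightarrow> 'c" and \<theta> \<theta>'
    where "free_minimal_cantor_system Z \<alpha>"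
      "bounded_orbit_injection X \<phi> Z \<alpha> \<theta>" "bounded_orbit_injection Y \<psi> Z \<alpha> \<theta>'"
    using assms(3) unfolding bounded_orbit_injection_equivalent_def by blast
  then have XZ: "bounded_orbit_inj X \<phi> Z \<alpha> \<theta>" and YZ: "bounded_orbit_inj Y \<psi> Z \<alpha> \<theta>'"
    using assms(1,2) by (blast intro: bounded_orbit_injI)+
  interpret Y: dyn_sys Y \<psi>
    using assms(2) by (simp add: dyn_sys_def free_minimal_cantor_system_def)
  obtain h k where h: "h \<in> iso (dyn_group X \<phi>) (dyn_group Z \<alpha>)"
      "h ` dyn_group_pos X \<phi> = dyn_group_pos Z \<alpha>"
    and k: "k \<in> iso (dyn_group Y \<psi>) (dyn_group Z \<alpha>)"
      "k ` dyn_group_pos Y \<psi> = dyn_group_pos Z \<alpha>"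
    using bounded_orbit_inj.ordered_iso[OF XZ] bounded_orbit_inj.ordered_iso[OF YZ] by blast
  \<comment> \<open>Both groups are identified with that of the common system Z, so one isomorphism
    is followed by the inverse of the other.\<close>
  let ?k' = "inv_into (carrier (dyn_group Y \<psi>)) k"
  interpret comm_group "dyn_group Y \<psi>"
    unfolding dyn_group_def by (rule Y.G.abelian_FactGroup[OF Y.coboundary_subgroup])
  have "?k' \<circ> h \<in> iso (dyn_group X \<phi>) (dyn_group Y \<psi>)"
    by (rule iso_set_trans[OF h(1) iso_set_sym[OF k(1)]])
  moreover have "(?k' \<circ> h) ` dyn_group_pos X \<phi> = dyn_group_pos Y \<psi>"
  proof -
    \<comment> \<open>The positive cone lies in the carrier, where k is injective, so the inverse
      carries the cone of Z back onto the cone of Y.\<close>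
    have "inj_on k (carrier (dyn_group Y \<psi>))" using k(1) by (simp add: iso_def bij_betw_def)
    moreover have "dyn_group_pos Y \<psi> \<subseteq> carrier (dyn_group Y \<psi>)"
      by (auto simp: dyn_group_pos_def dyn_group_def FactGroup_def RCOSETS_def)
    ultimately show ?thesis
      unfolding image_comp[symmetric] h(2) k(2)[symmetric] by (rule inv_into_image_cancel)
  qed
  ultimately show ?thesis by blast
qed

end
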